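(* Let $p\ge1$, $\lambda>0$, $c\ge0$ and $\varepsilon_k=\frac{c}{(k+1)^{p+1}}$ for $k\in\mathbb{N}_0$. Put $A_k:=k^{p+1}$ for $k\ge0$ and $a_k:=A_k-A_{k-1}$ for $k\ge1$. Let $(x^k,y^k)_{k\in\mathbb{N}_0}$ be a sequence generated by the inexact power augmented Lagrangian method with averaging (described in the context) with $\theta_k=\frac{A_k}{A_{k+1}}$ and termination criterion $$L(x^{k+1},y^{k+1})\le\inf_{x\in\mathbb{R}^n}L(x,y^{k+1})+\varepsilon_k\qquad\text{for all }k\in\mathbb{N}_0.$$ For $K\ge1$ let $\breve x^K:=\frac{\sum_{k=1}^Ka_kx^k}{\sum_{k=1}^Ka_k}$. Then for all $K\ge1$, all $x\in\mathbb{R}^n$ and all $y\in\mathbb{R}^m$, $$L(\breve x^K,y)-L(x,y^K)\le\frac{c+(\lambda\star\phi)(y^0-y)\,(p+1)^{p+1}}{K^p}.$$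
   Context: Problem and Lagrangian. $f:\mathbb{R}^n\to\mathbb{R}\cup\{+\infty\}$ and $g:\mathbb{R}^m\to\mathbb{R}\cup\{+\infty\}$ are proper, lower semicontinuous and convex, and $\mathcal{A}:\mathbb{R}^n\to\mathbb{R}^m$ is a (possibly nonlinear) mapping. The primal problem is $\inf_{x}\{\varphi(x):=f(x)+g(\mathcal{A}(x))\}$, which is convex, and its Lagrangian $$L(x,y)=f(x)+\langle\mathcal{A}(x),y\rangle-g^*(y)$$ is convex in $x$ and concave in $y$ ($g^*$ is the convex conjugate; $L(x,y)=+\infty$ if $x\notin\operatorname{dom}f$, and $L(x,y)=-\infty$ if $x\in\operatorname{dom}f$, $y\notin\operatorname{dom}g^*$). Standing assumption: strong duality $\sup_y\inf_xL(x,y)=\inf_x\varphi(x)$ holds and primal and dual solutions exist. Prox-function. $\|\cdot\|$ denotes $\|\cdot\|_r$ on $\mathbb{R}^m$, where either $r=2$ or $r=p+1$; $\phi:=\frac1{p+1}\|\cdot\|^{p+1}$; its convex conjugate is $\phi^*=\frac1{q+1}\|\cdot\|_*^{q+1}$ with $\frac1{p+1}+\frac1{q+1}=1$ and $\|\cdot\|_*$ the dual norm. The epi-scaling is $(\lambda\star\phi)(x)=\lambda\phi(\lambda^{-1}x)=\lambda^{-p}\frac1{p+1}\|x\|^{p+1}$. Augmented Lagrangian: $L_\lambda(x,y):=\sup_{\eta\in\mathbb{R}^m}\{L(x,\eta)-(\lambda\star\phi)(y-\eta)\}$. For $x\in\operatorname{dom}f$ it is differentiable in $y$, with $\nabla_yL_\lambda(x,y)=-\nabla\phi(\lambda^{-1}(y-\bar\eta))$,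 where $\bar\eta$ is the unique maximizer in the definition of $L_\lambda(x,y)$. Inexact power augmented Lagrangian method with averaging: given $x^0\in\mathbb{R}^n$, $y^0\in\mathbb{R}^m$ and $\theta_k\in[0,1]$, for $k=0,1,\dots$ set $w^k=\theta_ky^k+(1-\theta_k)y^0$, choose $x^{k+1}\approx\operatorname{argmin}_xL_\lambda(x,w^k)$ (approximately, as quantified by the termination criterion in the claim, with $x^{k+1}\in\operatorname{dom}f$), and set $$y^{k+1}=w^k+\lambda\nabla\phi^*\big(\nabla_yL_\lambda(x^{k+1},w^k)\big).$$ *)

theory Defs
  imports "HOL-Analysis.Analysis"
begin

text \<open>
  Functions into \<open>\<real> \<union> {\<plusminus>\<infinity>}\<close> are functions into \<^typ>\<open>ereal\<close>. In \<^typ>\<open>ereal\<close> one has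
  \<open>\<infinity> + (-\<infinity>) = \<infinity> - \<infinity> = \<infinity>\<close>.
\<close>

definition proper :: "('a \<Rightarrow> ereal) \<Rightarrow> bool" where
  "proper h \<longleftrightarrow> (\<forall>x. h x \<noteq> -\<infinity>) \<and> (\<exists>x. h x \<noteq> \<infinity>)"

definition lsc :: "('a::topological_space \<Rightarrow> ereal) \<Rightarrow> bool" where
  "lsc h \<longleftrightarrow> (\<forall>x. h x \<le> Liminf (at x) h)"

text \<open>
  Convexity of the epigraph, so that no convention for \<open>\<infinity> - \<infinity>\<close> enters for functions that take
  both infinite values (as the Lagrangian does).
\<close>

definition convex_fun :: "('a::real_vector \<Rightarrow> ereal) \<Rightarrow> bool" where
  "convex_fun h \<longleftrightarrow> convex {(x, t :: real). h x \<le> ereal t}"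

definition concave_fun :: "('a::real_vector \<Rightarrow> ereal) \<Rightarrow> bool" where
  "concave_fun h \<longleftrightarrow> convex_fun (\<lambda>x. - h x)"

definition effective_domain :: "('a \<Rightarrow> ereal) \<Rightarrow> 'a set" where
  "effective_domain h = {x. h x < \<infinity>}"

definition conjugate :: "('a::real_inner \<Rightarrow> ereal) \<Rightarrow> 'a \<Rightarrow> ereal" where
  "conjugate h u = (SUP x. ereal (x \<bullet> u) - h x)"

text \<open>Meaningful only where \<open>h\<close> is differentiable; the value is unspecified elsewhere.\<close>

definition grad :: "('a::real_inner \<Rightarrow> real) \<Rightarrow> 'a \<Rightarrow> 'a" where
  "grad h x = (THE D. GDERIV h x :> D)"

definition lnorm :: "real \<Rightarrow> real ^ 'm \<Rightarrow> real" where
  "lnorm r x = (\<Sum>i\<in>UNIV. \<bar>x $ i\<bar> powr r) powr (1 / r)"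

definition prox_fun :: "real \<Rightarrow> real \<Rightarrow> real ^ 'm \<Rightarrow> real" where
  "prox_fun r p x = 1 / (p + 1) * lnorm r x powr (p + 1)"

text \<open>
  The conjugate of \<^const>\<open>prox_fun\<close> is finite everywhere (it is
  \<open>1 / (q + 1) * dual_norm u powr (q + 1)\<close> with \<open>1 / (p + 1) + 1 / (q + 1) = 1\<close>), so passing to
  \<^typ>\<open>real\<close> loses nothing.
\<close>

definition prox_conj :: "real \<Rightarrow> real \<Rightarrow> real ^ 'm \<Rightarrow> real" where
  "prox_conj r p u = real_of_ereal (conjugate (\<lambda>x. ereal (prox_fun r p x)) u)"

definition epi_scale :: "real \<Rightarrow> ('a::real_vector \<Rightarrow> real) \<Rightarrow> 'a \<Rightarrow> real" where
  "epi_scale lam h x = lam * h (x /\<^sub>R lam)"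

definition primal_obj ::
    "('a \<Rightarrow> ereal) \<Rightarrow> ('b \<Rightarrow> ereal) \<Rightarrow> ('a \<Rightarrow> 'b) \<Rightarrow> 'a \<Rightarrow> ereal" where
  "primal_obj f g \<A> x = f x + g (\<A> x)"

definition lagrangian ::
    "('a \<Rightarrow> ereal) \<Rightarrow> ('b::real_inner \<Rightarrow> ereal) \<Rightarrow> ('a \<Rightarrow> 'b) \<Rightarrow> 'a \<Rightarrow> 'b \<Rightarrow> ereal" where
  "lagrangian f g \<A> x y =
     (if x \<notin> effective_domain f then \<infinity>
      else if y \<notin> effective_domain (conjugate g) then -\<infinity>
      else f x + ereal (\<A> x \<bullet> y) - conjugate g y)"

definition aug_lagrangian ::
    "('a \<Rightarrow> ereal) \<Rightarrow> (real ^ 'm \<Rightarrow> ereal) \<Rightarrow> ('a \<Rightarrow> real ^ 'm) \<Rightarrow> real \<Rightarrow> real \<Rightarrow> real \<Rightarrow>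
      'a \<Rightarrow> real ^ 'm \<Rightarrow> ereal" where
  "aug_lagrangian f g \<A> r p lam x y =
     (SUP \<eta>. lagrangian f g \<A> x \<eta> - ereal (epi_scale lam (prox_fun r p) (y - \<eta>)))"

text \<open>
  For \<open>x\<close> in the effective domain of \<open>f\<close> the augmented Lagrangian is finite in \<open>y\<close>, and this is the
  gradient in \<open>y\<close>.
\<close>

definition grad_aug_lagrangian ::
    "('a \<Rightarrow> ereal) \<Rightarrow> (real ^ 'm \<Rightarrow> ereal) \<Rightarrow> ('a \<Rightarrow> real ^ 'm) \<Rightarrow> real \<Rightarrow> real \<Rightarrow> real \<Rightarrow>
      'a \<Rightarrow> real ^ 'm \<Rightarrow> real ^ 'm" where
  "grad_aug_lagrangian f g \<A> r p lam x y =
     grad (\<lambda>y'. real_of_ereal (aug_lagrangian f g \<A> r p lam x y')) y"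

text \<open>
  Sequences generated by the inexact method with averaging. The sense in which \<open>x (Suc k)\<close>
  approximately minimises the augmented Lagrangian at \<open>w\<close> is not part of this predicate; it is
  given by a separate termination criterion.
\<close>

definition inexact_power_alm ::
    "('a \<Rightarrow> ereal) \<Rightarrow> (real ^ 'm \<Rightarrow> ereal) \<Rightarrow> ('a \<Rightarrow> real ^ 'm) \<Rightarrow> real \<Rightarrow> real \<Rightarrow> real \<Rightarrow>
      (nat \<Rightarrow> real) \<Rightarrow> (nat \<Rightarrow> 'a) \<Rightarrow> (nat \<Rightarrow> real ^ 'm) \<Rightarrow> bool" where
  "inexact_power_alm f g \<A> r p lam \<theta> x y \<longleftrightarrow>
     (\<forall>k. \<theta> k \<in> {0..1} \<and>
          x (Suc k) \<in> effective_domain f \<and>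
          (let w = \<theta> k *\<^sub>R y k + (1 - \<theta> k) *\<^sub>R y 0
           in y (Suc k) =
                w + lam *\<^sub>R grad (prox_conj r p) (grad_aug_lagrangian f g \<A> r p lam (x (Suc k)) w)))"

end

theory Submission
  imports Defs
begin

text \<open>
  Write \<open>C\<close> for the domain of the conjugate of \<open>g\<close> and \<open>\<psi>\<close> for the epi-scaled prox-function, which is
  positively homogeneous of degree \<open>p + 1\<close>. The proof rests on reading the multiplier update as an
  exact proximal step: \<open>y (k+1)\<close> maximises \<open>L (x (k+1)) \<eta> - \<psi> (w k - \<eta>)\<close> over \<open>\<eta>\<close>
  (\<open>alm_update_is_prox\<close>). Indeed a maximiser \<open>e\<close> exists, the gradient of the augmented Lagrangian at
  \<open>w\<close> is the gradient of the prox-function at \<open>(e - w) / lam\<close> (\<open>GDERIV_envelope\<close>), and the gradient of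
  the conjugate prox-function undoes that gradient (\<open>GDERIV_conjugate\<close>), so the update returns \<open>e\<close>.

  Since \<open>w k = \<theta> y k + (1 - \<theta>) y 0\<close>, the comparison point \<open>\<theta> y k + (1 - \<theta>) v\<close> differs from \<open>w k\<close> by
  \<open>(1 - \<theta>) (y 0 - v)\<close>. Concavity of \<open>L\<close> in its second argument and homogeneity then give
  (\<open>prox_test_point\<close>)
    \<open>L (x (k+1)) (y (k+1)) \<ge> \<theta> L (x (k+1)) (y k) + (1 - \<theta>) L (x (k+1)) v - (1 - \<theta>)^(p+1) \<psi> (y 0 - v)\<close>.
  Multiply by \<open>A (k+1)\<close>. The coefficients of the two values of \<open>L\<close> become \<open>A k\<close> and \<open>a (k+1)\<close>, and since
  \<open>a (k+1) \<le> (p+1) (k+1)^p\<close> the error coefficient \<open>A (k+1) (1 - \<theta>)^(p+1)\<close> is at most \<open>(p+1)^(p+1)\<close>.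
  The stopping rule replaces \<open>L (x (k+1)) (y k)\<close> by \<open>L (x k) (y k)\<close> at the cost of \<open>A k \<epsilon> (k-1) = c\<close>, so
  the sum telescopes. After \<open>K\<close> steps both errors have grown linearly in \<open>K\<close>, the weights sum to
  \<open>A K = K^(p+1)\<close>, and convexity of \<open>L\<close> in its first argument passes to the averaged primal point:
  dividing by \<open>A K\<close> yields the rate \<open>1 / K^p\<close>.
\<close>

section \<open>Gradients and powers of norms\<close>

lemma GDERIV_iff_eps:
  "GDERIV f x :> D \<longleftrightarrow>
    (\<forall>e>0. \<exists>d>0. \<forall>y. norm (y - x) < d \<longrightarrow> \<bar>f y - f x - D \<bullet> (y - x)\<bar> \<le> e * norm (y - x))"
  unfolding gderiv_def has_derivative_at_alt
  by (simp add: bounded_linear_inner_left inner_commute)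

lemma GDERIV_unique:
  assumes "GDERIV f x :> D" "GDERIV f x :> E" shows "D = E"
proof -
  have "(\<lambda>h. h \<bullet> D) = (\<lambda>h. h \<bullet> E)"
    using assms unfolding gderiv_def by (rule has_derivative_unique)
  then have "(D - E) \<bullet> (D - E) = 0"
    by (metis inner_diff_right cancel_comm_monoid_add_class.diff_cancel)
  then show ?thesis by simp
qed

lemma grad_eqI: "GDERIV f x :> D \<Longrightarrow> grad f x = D"
  unfolding grad_def by (blast intro: the_equality GDERIV_unique)

lemma GDERIV_sandwich:
  assumes "GDERIV l x :> D" "GDERIV u x :> D"
    and "\<And>y. l y \<le> f y" "\<And>y. f y \<le> u y" "l x = f x" "u x = f x"
  shows "GDERIV f x :> D"
  unfolding GDERIV_iff_eps
proof (intro allI impI)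
  fix e :: real assume "e > 0"
  obtain d1 where d1: "d1 > 0" "\<And>y. norm (y - x) < d1 \<Longrightarrow> \<bar>l y - l x - D \<bullet> (y - x)\<bar> \<le> e * norm (y - x)"
    using assms(1) \<open>e > 0\<close> unfolding GDERIV_iff_eps by blast
  obtain d2 where d2: "d2 > 0" "\<And>y. norm (y - x) < d2 \<Longrightarrow> \<bar>u y - u x - D \<bullet> (y - x)\<bar> \<le> e * norm (y - x)"
    using assms(2) \<open>e > 0\<close> unfolding GDERIV_iff_eps by blast
  show "\<exists>d>0. \<forall>y. norm (y - x) < d \<longrightarrow> \<bar>f y - f x - D \<bullet> (y - x)\<bar> \<le> e * norm (y - x)"
  proof (intro exI[of _ "min d1 d2"] conjI allI impI)
    fix y assume "norm (y - x) < min d1 d2"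
    then show "\<bar>f y - f x - D \<bullet> (y - x)\<bar> \<le> e * norm (y - x)"
      using d1(2)[of y] d2(2)[of y] assms(3,4)[of y] assms(5,6) by linarith
  qed (use d1 d2 in auto)
qed

text \<open>
  Mean value theorem, the derivative being strictly increasing. Besides strict convexity of the
  prox-functions, the inequality bounds the weights of the method: at \<open>a = k + 1\<close> and \<open>t = k\<close> it
  estimates the increment of \<open>k powr s\<close>.
\<close>
lemma powr_tangent:
  fixes t a s :: real
  assumes "s > 1" "t \<ge> 0" "a \<ge> 0" "t \<noteq> a"
  shows "a powr s + s * a powr (s - 1) * (t - a) < t powr s"
proof -
  consider "a = 0" | "t = 0" "a > 0" | "t > 0" "a > 0" using assms by linarith
  then show ?thesis
  proof cases
    case 1 then show ?thesis using assms by simp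
  next
    case 2
    have "a powr (s - 1) * a = a powr s" using 2 by (simp add: powr_mult_base mult.commute)
    then have "s * a powr (s - 1) * (0 - a) = - (s * a powr s)" by (simp add: mult.assoc)
    moreover have "1 * a powr s < s * a powr s"
      using 2 assms by (intro mult_strict_right_mono) auto
    ultimately show ?thesis unfolding \<open>t = 0\<close> by (simp only: powr_zero_eq_one powr_0)
  next
    case 3
    have D: "((\<lambda>t. t powr s) has_real_derivative s * \<xi> powr (s - 1)) (at \<xi>)" if "\<xi> > 0" for \<xi>
      using that by (rule has_real_derivative_powr)
    have "t < a \<or> a < t" using assms by linarith
    then show ?thesis
    proof
      assume "a < t"
      then obtain \<xi> where xi: "a < \<xi>" "\<xi> < t" "t powr s - a powr s = (t - a) * (s * \<xi> powr (s - 1))"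
        using MVT2[of a t "\<lambda>t. t powr s" "\<lambda>t. s * t powr (s - 1)"] D 3 by force
      have "a powr (s - 1) < \<xi> powr (s - 1)" using xi assms 3 by (intro powr_less_mono2) auto
      then have "(t - a) * (s * a powr (s - 1)) < (t - a) * (s * \<xi> powr (s - 1))"
        using \<open>a < t\<close> assms by simp
      then show ?thesis using xi by (simp add: algebra_simps)
    next
      assume "t < a"
      then obtain \<xi> where xi: "t < \<xi>" "\<xi> < a" "a powr s - t powr s = (a - t) * (s * \<xi> powr (s - 1))"
        using MVT2[of t a "\<lambda>t. t powr s" "\<lambda>t. s * t powr (s - 1)"] D 3 by force
      have "\<xi> powr (s - 1) < a powr (s - 1)" using xi assms 3 by (intro powr_less_mono2) auto
      then have "(a - t) * (s * \<xi> powr (s - 1)) < (a - t) * (s * a powr (s - 1))"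
        using \<open>t < a\<close> assms by simp
      then show ?thesis using xi by (simp add: algebra_simps)
    qed
  qed
qed

lemma GDERIV_norm_powr:
  fixes z :: "'a::real_inner"
  assumes "s > 1"
  shows "GDERIV (\<lambda>x. norm x powr s) z :> (s * norm z powr (s - 2)) *\<^sub>R z"
proof (cases "z = 0")
  case True
  show ?thesis
    unfolding GDERIV_iff_eps
  proof (intro allI impI)
    fix e :: real assume e: "e > 0"
    show "\<exists>d>0. \<forall>y. norm (y - z) < d \<longrightarrow>
      \<bar>norm y powr s - norm z powr s - (s * norm z powr (s - 2)) *\<^sub>R z \<bullet> (y - z)\<bar> \<le> e * norm (y - z)"
    proof (intro exI[of _ "e powr (1 / (s - 1))"] conjI allI impI)
      fix y :: 'a assume "norm (y - z) < e powr (1 / (s - 1))"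
      then have "norm y powr (s - 1) \<le> (e powr (1 / (s - 1))) powr (s - 1)"
        using assms True by (intro powr_mono2) auto
      also have "\<dots> = e" using e assms by (simp add: powr_powr)
      finally have "norm y powr (s - 1) * norm y \<le> e * norm y" by (simp add: mult_right_mono)
      moreover have "norm y powr (s - 1) * norm y = norm y powr s"
        by (simp add: powr_mult_base mult.commute)
      ultimately show "\<bar>norm y powr s - norm z powr s - (s * norm z powr (s - 2)) *\<^sub>R z \<bullet> (y - z)\<bar>
          \<le> e * norm (y - z)" using True assms by simp
    qed (use e in auto)
  qed
next
  case False
  have "GDERIV (\<lambda>x. norm x powr s) z :> (s * norm z powr (s - 1)) *\<^sub>R sgn z"
    using False by (intro GDERIV_DERIV_compose GDERIV_norm has_real_derivative_powr) auto
  moreover have "norm z powr (s - 1) / norm z = norm z powr (s - 2)"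
    using False powr_diff[of "norm z" "s - 1" 1] by simp
  then have "(s * norm z powr (s - 1)) *\<^sub>R sgn z = (s * norm z powr (s - 2)) *\<^sub>R z"
    unfolding sgn_div_norm scaleR_scaleR by (simp add: divide_inverse mult.assoc)
  ultimately show ?thesis by simp
qed

text \<open>
  Reduction to the scalar inequality along the norms by Cauchy-Schwarz. Strictness comes from one of
  two sources: the norms differ, or they agree and Cauchy-Schwarz is strict.
\<close>
lemma norm_powr_tangent:
  fixes x z :: "'a::real_inner"
  assumes "s > 1" "x \<noteq> z"
  shows "norm z powr s + ((s * norm z powr (s - 2)) *\<^sub>R z) \<bullet> (x - z) < norm x powr s"
proof (cases "z = 0")
  case True then show ?thesis using assms by simp
next
  case False
  have e1: "norm z powr (s - 1) = norm z powr (s - 2) * norm z"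
    using False powr_mult_base[of "norm z" "s - 2"] by (simp add: mult.commute)
  have "((s * norm z powr (s - 2)) *\<^sub>R z) \<bullet> (x - z)
      = s * norm z powr (s - 2) * (z \<bullet> x - norm z * norm z)"
    by (simp add: inner_diff_right right_diff_distrib flip: power2_eq_square power2_norm_eq_inner)
  also have "\<dots> = s * norm z powr (s - 1) * (norm x - norm z)
        - s * norm z powr (s - 2) * (norm z * norm x - z \<bullet> x)"
    unfolding e1 by (simp add: algebra_simps)
  finally have eq: "((s * norm z powr (s - 2)) *\<^sub>R z) \<bullet> (x - z)
      = s * norm z powr (s - 1) * (norm x - norm z)
        - s * norm z powr (s - 2) * (norm z * norm x - z \<bullet> x)" .
  have pos: "s * norm z powr (s - 2) > 0" using False assms by simp
  have cs: "z \<bullet> x \<le> norm z * norm x" by (rule norm_cauchy_schwarz)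
  show ?thesis
  proof (cases "norm x = norm z")
    case True
    have "z \<bullet> x \<noteq> norm z * norm x"
    proof
      assume "z \<bullet> x = norm z * norm x"
      then have "norm z *\<^sub>R x = norm x *\<^sub>R z" by (simp add: norm_cauchy_schwarz_eq)
      then show False using True False assms by simp
    qed
    then have "s * norm z powr (s - 2) * (norm z * norm x - z \<bullet> x) > 0"
      using cs pos by (intro mult_pos_pos[OF pos]) auto
    then show ?thesis using eq True by simp
  next
    case False
    have "s * norm z powr (s - 2) * (norm z * norm x - z \<bullet> x) \<ge> 0"
      using cs pos by (intro mult_nonneg_nonneg[OF less_imp_le[OF pos]]) auto
    then show ?thesis using eq powr_tangent[OF assms(1), of "norm x" "norm z"] False by simp
  qed
qed

section \<open>Strictly convex homogeneous prox-functions\<close>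

text \<open>
  The properties common to both choices of the prox-function: differentiability, strict convexity (as
  a strict tangent inequality) and homogeneity of degree \<open>s > 1\<close>. Homogeneity is with respect to all
  real factors, so it contains evenness.
\<close>
locale prox_kernel =
  fixes \<phi> :: "'b::euclidean_space \<Rightarrow> real" and D :: "'b \<Rightarrow> 'b" and s :: real
  assumes GDERIV_phi: "GDERIV \<phi> z :> D z"
    and tangent: "x \<noteq> z \<Longrightarrow> \<phi> z + D z \<bullet> (x - z) < \<phi> x"
    and homogeneous: "\<phi> (t *\<^sub>R x) = \<bar>t\<bar> powr s * \<phi> x"
    and s_gt_1: "1 < s"
begin

lemma tangent_le: "\<phi> z + D z \<bullet> (x - z) \<le> \<phi> x"
  using tangent[of x z] by (cases "x = z") auto

lemma phi_zero [simp]: "\<phi> 0 = 0"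
  using homogeneous[of 0 0] s_gt_1 by simp

lemma phi_minus [simp]: "\<phi> (- x) = \<phi> x"
  using homogeneous[of "-1" x] by simp

lemma phi_pos: "x \<noteq> 0 \<Longrightarrow> \<phi> x > 0"
  using tangent[of x 0] tangent[of "- x" 0] by simp

lemma phi_nonneg: "\<phi> x \<ge> 0"
  using phi_pos[of x] by (cases "x = 0") auto

lemma continuous_phi: "continuous_on S \<phi>"
  by (meson GDERIV_phi gderiv_def has_derivative_continuous continuous_at_imp_continuous_on)

text \<open>
  Compactness of the unit sphere and homogeneity.
\<close>
lemma growth: obtains \<mu> where "\<mu> > 0" "\<And>x. \<mu> * norm x powr s \<le> \<phi> x"
proof -
  have "compact (sphere (0::'b) 1)" "sphere (0::'b) 1 \<noteq> {}" by auto
  from continuous_attains_inf[OF this continuous_phi]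
  obtain m where m: "m \<in> sphere (0::'b) 1" "\<And>x. x \<in> sphere 0 1 \<Longrightarrow> \<phi> m \<le> \<phi> x"
    by (elim bexE) blast
  show ?thesis
  proof
    show "\<phi> m > 0" using m by (intro phi_pos) auto
    show "\<phi> m * norm x powr s \<le> \<phi> x" for x
    proof (cases "x = 0")
      case False
      have "\<phi> x = \<phi> (norm x *\<^sub>R sgn x)" using False by (simp add: sgn_div_norm)
      also have "\<dots> = norm x powr s * \<phi> (sgn x)" by (subst homogeneous) simp
      also have "\<dots> \<ge> norm x powr s * \<phi> m" using m(2)[of "sgn x"] False
        by (intro mult_left_mono) (auto simp: norm_sgn)
      finally show ?thesis by (simp add: mult.commute)
    qed simp
  qed
qed

text \<open>
  The gap between the function and its tangent at \<open>z\<close> is positive on the sphere of radius \<open>\<delta>\<close>, hence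
  bounded below there; being convex and zero at \<open>z\<close>, it grows at least linearly beyond.
\<close>
lemma tangent_gap_linear_growth:
  assumes "\<delta> > 0"
  obtains \<nu> where "\<nu> > 0"
    "\<And>x. norm (x - z) \<ge> \<delta> \<Longrightarrow> \<nu> * norm (x - z) \<le> \<phi> x - \<phi> z - D z \<bullet> (x - z)"
proof -
  let ?B = "\<lambda>x. \<phi> x - \<phi> z - D z \<bullet> (x - z)"
  have "compact (sphere z \<delta>)" "sphere z \<delta> \<noteq> {}" using assms by auto
  moreover have "continuous_on (sphere z \<delta>) ?B" by (intro continuous_intros continuous_phi)
  ultimately have "\<exists>m\<in>sphere z \<delta>. \<forall>x\<in>sphere z \<delta>. ?B m \<le> ?B x"
    by (rule continuous_attains_inf)
  then obtain m where m: "m \<in> sphere z \<delta>" "\<And>x. x \<in> sphere z \<delta> \<Longrightarrow> ?B m \<le> ?B x"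
    by (elim bexE) blast
  show ?thesis
  proof
    have "m \<noteq> z" using m(1) assms by auto
    then have "?B m > 0" using tangent[of m z] by simp
    then show "?B m / \<delta> > 0" using assms by simp
    fix x assume x: "norm (x - z) \<ge> \<delta>"
    define t where "t = \<delta> / norm (x - z)"
    have nz: "norm (x - z) > 0" using x assms by linarith
    have t: "0 < t" "t \<le> 1" using x assms nz by (auto simp: t_def)
    define p where "p = z + t *\<^sub>R (x - z)"
    have "p \<in> sphere z \<delta>" using nz assms by (simp add: p_def t_def dist_norm)
    then have "?B m \<le> ?B p" by (rule m)
    also have "?B p \<le> t * ?B x"
    proof -
      have "\<phi> p + D p \<bullet> (x - p) \<le> \<phi> x" "\<phi> p + D p \<bullet> (z - p) \<le> \<phi> z" by (rule tangent_le)+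
      then have "t * (\<phi> p + D p \<bullet> (x - p)) + (1 - t) * (\<phi> p + D p \<bullet> (z - p)) \<le> t * \<phi> x + (1 - t) * \<phi> z"
        using t by (intro add_mono mult_left_mono) auto
      moreover have "t * (\<phi> p + D p \<bullet> (x - p)) + (1 - t) * (\<phi> p + D p \<bullet> (z - p))
        = \<phi> p + D p \<bullet> (t *\<^sub>R (x - p) + (1 - t) *\<^sub>R (z - p))"
        by (simp add: inner_add_right algebra_simps)
      moreover have "t *\<^sub>R (x - p) + (1 - t) *\<^sub>R (z - p) = 0"
        by (simp add: p_def algebra_simps)
      then have "D p \<bullet> (t *\<^sub>R (x - p) + (1 - t) *\<^sub>R (z - p)) = 0" by simp
      moreover have "D z \<bullet> (p - z) = t * (D z \<bullet> (x - z))" by (simp add: p_def)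
      ultimately have "\<phi> p \<le> t * \<phi> x + (1 - t) * \<phi> z" "D z \<bullet> (p - z) = t * (D z \<bullet> (x - z))"
        by linarith+
      then show ?thesis by (simp add: algebra_simps)
    qed
    finally show "?B m / \<delta> * norm (x - z) \<le> ?B x"
      using nz assms by (simp add: t_def field_simps)
  qed
qed

text \<open>
  The gradient of the conjugate inverts the gradient \<open>D\<close>. The lower bound is the affine function
  obtained by testing the supremum at \<open>z\<close>. For the upper bound at \<open>D z + h\<close>, a point \<open>x\<close> contributes
  at most \<open>h \<bullet> (x - z)\<close> minus the tangent gap at \<open>x\<close> beyond that affine function; for small \<open>h\<close> the
  linear growth of the gap makes this nonpositive when \<open>x\<close> is at distance at least \<open>e\<close> from \<open>z\<close>, and
  points closer than \<open>e\<close> contribute at most \<open>e * norm h\<close>.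
\<close>
lemma GDERIV_conjugate:
  "GDERIV (\<lambda>u. real_of_ereal (conjugate (\<lambda>x. ereal (\<phi> x)) u)) (D z) :> z"
  unfolding GDERIV_iff_eps
proof (intro allI impI)
  fix e :: real assume e: "e > 0"
  let ?c = "\<lambda>u. conjugate (\<lambda>x. ereal (\<phi> x)) u"
  obtain \<nu> where nu: "\<nu> > 0"
    "\<And>x. norm (x - z) \<ge> e \<Longrightarrow> \<nu> * norm (x - z) \<le> \<phi> x - \<phi> z - D z \<bullet> (x - z)"
    using tangent_gap_linear_growth[OF e] by blast
  have lower: "ereal (z \<bullet> u - \<phi> z) \<le> ?c u" for u
    unfolding conjugate_def by (rule SUP_upper2[of z]) auto
  have upper: "?c u \<le> ereal (z \<bullet> u - \<phi> z + e * norm (u - D z))" if "norm (u - D z) < \<nu>" for u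
    unfolding conjugate_def
  proof (rule SUP_least)
    fix x
    let ?h = "u - D z"
    have split: "x \<bullet> u - \<phi> x = z \<bullet> u - \<phi> z + ?h \<bullet> (x - z) - (\<phi> x - \<phi> z - D z \<bullet> (x - z))"
      by (simp add: algebra_simps inner_commute)
    have cs: "?h \<bullet> (x - z) \<le> norm ?h * norm (x - z)" by (rule norm_cauchy_schwarz)
    have "?h \<bullet> (x - z) - (\<phi> x - \<phi> z - D z \<bullet> (x - z)) \<le> e * norm ?h"
    proof (cases "norm (x - z) \<ge> e")
      case True
      have "norm ?h * norm (x - z) \<le> \<nu> * norm (x - z)" using that by (intro mult_right_mono) auto
      moreover have "0 \<le> e * norm ?h" using e by simp
      ultimately show ?thesis using nu(2)[OF True] cs by linarith
    next
      case False
      then have "norm ?h * norm (x - z) \<le> norm ?h * e" by (intro mult_left_mono) auto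
      then show ?thesis using tangent_le[of z x] cs by (simp add: mult.commute)
    qed
    then show "ereal (x \<bullet> u) - ereal (\<phi> x) \<le> ereal (z \<bullet> u - \<phi> z + e * norm ?h)"
      using split by simp
  qed
  have bounds: "z \<bullet> u - \<phi> z \<le> real_of_ereal (?c u)"
    "real_of_ereal (?c u) \<le> z \<bullet> u - \<phi> z + e * norm (u - D z)" if "norm (u - D z) < \<nu>" for u
    using lower[of u] upper[OF that] by (cases "?c u"; simp)+
  have at: "real_of_ereal (?c (D z)) = z \<bullet> D z - \<phi> z"
    using bounds[of "D z"] nu by simp
  show "\<exists>d>0. \<forall>u. norm (u - D z) < d \<longrightarrow>
      \<bar>real_of_ereal (?c u) - real_of_ereal (?c (D z)) - z \<bullet> (u - D z)\<bar> \<le> e * norm (u - D z)"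
  proof (intro exI[of _ \<nu>] conjI allI impI)
    fix u assume "norm (u - D z) < \<nu>"
    then show "\<bar>real_of_ereal (?c u) - real_of_ereal (?c (D z)) - z \<bullet> (u - D z)\<bar> \<le> e * norm (u - D z)"
      using bounds[of u] unfolding at inner_diff_right by linarith
  qed (use nu in auto)
qed

section \<open>Proximal points and envelopes\<close>

lemma prox_kernel_epi_scale:
  assumes "lam > 0"
  shows "prox_kernel (epi_scale lam \<phi>) (\<lambda>z. D (z /\<^sub>R lam)) s"
proof
  fix x z :: 'b and t :: real
  have "(\<phi> has_derivative (\<lambda>h. h \<bullet> D (z /\<^sub>R lam))) (at (z /\<^sub>R lam))"
    using GDERIV_phi unfolding gderiv_def .
  then have "((\<lambda>x. \<phi> (x /\<^sub>R lam)) has_derivative (\<lambda>h. (h /\<^sub>R lam) \<bullet> D (z /\<^sub>R lam))) (at z)"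
    by (rule has_derivative_compose[rotated]) (auto intro!: derivative_eq_intros)
  then have "((\<lambda>x. lam * \<phi> (x /\<^sub>R lam))
      has_derivative (\<lambda>h. lam * ((h /\<^sub>R lam) \<bullet> D (z /\<^sub>R lam)))) (at z)"
    by (rule has_derivative_mult_right)
  then show "GDERIV (epi_scale lam \<phi>) z :> D (z /\<^sub>R lam)"
    unfolding gderiv_def epi_scale_def using assms by (simp flip: mult.assoc)
  show "epi_scale lam \<phi> z + D (z /\<^sub>R lam) \<bullet> (x - z) < epi_scale lam \<phi> x" if "x \<noteq> z"
  proof -
    have "lam * (\<phi> (z /\<^sub>R lam) + D (z /\<^sub>R lam) \<bullet> (x /\<^sub>R lam - z /\<^sub>R lam)) < lam * \<phi> (x /\<^sub>R lam)"
      using that assms by (intro mult_strict_left_mono tangent) auto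
    moreover have "lam * (D (z /\<^sub>R lam) \<bullet> (x /\<^sub>R lam - z /\<^sub>R lam)) = D (z /\<^sub>R lam) \<bullet> (x - z)"
      using assms by (simp flip: scaleR_diff_right)
    ultimately show ?thesis unfolding epi_scale_def distrib_left by simp
  qed
  show "epi_scale lam \<phi> (t *\<^sub>R x) = \<bar>t\<bar> powr s * epi_scale lam \<phi> x"
  proof -
    have "(t *\<^sub>R x) /\<^sub>R lam = t *\<^sub>R (x /\<^sub>R lam)" by simp
    then show ?thesis unfolding epi_scale_def by (simp only: homogeneous) simp
  qed
qed (rule s_gt_1)

text \<open>
  The superlinear growth of \<open>\<phi>\<close> beats the affine minorant of \<open>h\<close>, so sublevel sets of the objective
  are bounded. The minimum is sought over pairs \<open>(\<eta>, t)\<close> in the closed epigraph of \<open>h\<close>: there the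
  objective \<open>t + \<phi> (w - \<eta>)\<close> is continuous although \<open>h\<close> need only be lower semicontinuous.
\<close>
lemma prox_point_exists:
  assumes "c0 \<in> C" and cl: "closed {(\<eta>, t). \<eta> \<in> C \<and> h \<eta> \<le> t}"
    and minorant: "\<And>\<eta>. \<eta> \<in> C \<Longrightarrow> \<alpha> + b \<bullet> \<eta> \<le> h \<eta>"
  obtains e where "e \<in> C" "\<And>\<eta>. \<eta> \<in> C \<Longrightarrow> h e + \<phi> (w - e) \<le> h \<eta> + \<phi> (w - \<eta>)"
proof -
  obtain \<mu> where mu: "\<mu> > 0" "\<And>x. \<mu> * norm x powr s \<le> \<phi> x"
    using growth by blast
  define m0 where "m0 = h c0 + \<phi> (w - c0)"
  define T where "T = {(\<eta>, t). \<eta> \<in> C \<and> h \<eta> \<le> t} \<inter> {q. snd q + \<phi> (w - fst q) \<le> m0}"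
  \<comment> \<open>A point at distance \<open>d \<ge> 1\<close> from \<open>w\<close> in the sublevel set satisfies \<open>d powr (s - 1) \<le> Q\<close>.\<close>
  define Q where "Q = (\<bar>m0 - \<alpha> - b \<bullet> w\<bar> + norm b) / \<mu>"
  define R where "R = max 1 (Q powr (1 / (s - 1)))"
  have cont: "continuous_on S (\<lambda>q. snd q + \<phi> (w - fst q))" for S
    by (intro continuous_intros continuous_on_compose2[OF continuous_phi[of UNIV]]) auto
  have "closed T"
    unfolding T_def using cont by (intro closed_Int cl closed_Collect_le continuous_on_const) auto
  moreover have "T \<subseteq> cball w R \<times> {\<alpha> + b \<bullet> w - norm b * R .. m0}"
  proof
    fix q assume "q \<in> T"
    then obtain \<eta> t where q: "q = (\<eta>, t)" "\<eta> \<in> C" "h \<eta> \<le> t" "t + \<phi> (w - \<eta>) \<le> m0"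
      by (auto simp: T_def)
    define d where "d = norm (w - \<eta>)"
    have "b \<bullet> (w - \<eta>) \<le> norm b * d" unfolding d_def by (rule norm_cauchy_schwarz)
    then have t: "\<alpha> + b \<bullet> w - norm b * d \<le> t"
      using minorant[OF q(2)] q(3) by (simp add: inner_diff_right)
    have "\<mu> * d powr s \<le> (m0 - \<alpha> - b \<bullet> w) + norm b * d"
      using t q(4) mu(2)[of "w - \<eta>"] unfolding d_def by linarith
    have "d \<le> R"
    proof (cases "d \<ge> 1")
      case True
      have "\<bar>m0 - \<alpha> - b \<bullet> w\<bar> * 1 \<le> \<bar>m0 - \<alpha> - b \<bullet> w\<bar> * d" using True by (intro mult_left_mono) auto
      with \<open>\<mu> * d powr s \<le> _\<close> have "\<mu> * d powr s \<le> (\<bar>m0 - \<alpha> - b \<bullet> w\<bar> + norm b) * d"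
        by (simp add: distrib_right)
      moreover have "d powr s = d powr (s - 1) * d"
        using True powr_mult_base[of d "s - 1"] by (simp add: mult.commute)
      ultimately have "(\<mu> * d powr (s - 1)) * d \<le> (\<bar>m0 - \<alpha> - b \<bullet> w\<bar> + norm b) * d"
        by (simp add: mult.assoc)
      then have "\<mu> * d powr (s - 1) \<le> \<bar>m0 - \<alpha> - b \<bullet> w\<bar> + norm b"
        using True by (subst (asm) mult_le_cancel_right) auto
      then have "d powr (s - 1) \<le> Q" using mu(1) by (simp add: Q_def field_simps)
      then have "(d powr (s - 1)) powr (1 / (s - 1)) \<le> Q powr (1 / (s - 1))"
        using s_gt_1 by (intro powr_mono2) auto
      moreover have "(d powr (s - 1)) powr (1 / (s - 1)) = d"
        using s_gt_1 True by (simp add: powr_powr)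
      ultimately show ?thesis by (simp add: R_def)
    qed (simp add: R_def)
    moreover have "norm b * d \<le> norm b * R" using \<open>d \<le> R\<close> by (intro mult_left_mono) auto
    moreover have "t \<le> m0" using q(4) phi_nonneg[of "w - \<eta>"] by linarith
    ultimately show "q \<in> cball w R \<times> {\<alpha> + b \<bullet> w - norm b * R .. m0}"
      using q(1) t by (auto simp: d_def dist_norm)
  qed
  then have "bounded T"
    by (rule bounded_subset[rotated]) (intro bounded_Times bounded_cball bounded_closed_interval)
  ultimately have "compact T" by (simp add: compact_eq_bounded_closed)
  moreover have c0: "(c0, h c0) \<in> T" using assms(1) by (auto simp: T_def m0_def)
  then have "T \<noteq> {}" by blast
  ultimately have "\<exists>m\<in>T. \<forall>q\<in>T. snd m + \<phi> (w - fst m) \<le> snd q + \<phi> (w - fst q)"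
    by (intro continuous_attains_inf cont)
  then obtain m where m: "m \<in> T" "\<And>q. q \<in> T \<Longrightarrow> snd m + \<phi> (w - fst m) \<le> snd q + \<phi> (w - fst q)"
    by blast
  show ?thesis
  proof
    show "fst m \<in> C" using m(1) by (auto simp: T_def)
    have le: "h (fst m) \<le> snd m" "snd m + \<phi> (w - fst m) \<le> m0" using m(1) by (auto simp: T_def)
    fix \<eta> assume "\<eta> \<in> C"
    show "h (fst m) + \<phi> (w - fst m) \<le> h \<eta> + \<phi> (w - \<eta>)"
    proof (cases "h \<eta> + \<phi> (w - \<eta>) \<le> m0")
      case True
      then have "(\<eta>, h \<eta>) \<in> T" using \<open>\<eta> \<in> C\<close> by (auto simp: T_def)
      from m(2)[OF this] le show ?thesis by simp
    qed (use le in linarith)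
  qed
qed

lemma phi_diff_commute: "\<phi> (x - y) = \<phi> (y - x)"
  using phi_minus[of "x - y"] by simp

text \<open>
  First-order optimality condition: \<open>- D (e - w)\<close> is a subgradient of \<open>h\<close> at \<open>e\<close>. It is obtained by
  comparing \<open>e\<close> with points on the segment to \<open>\<eta>\<close> and letting them tend to \<open>e\<close>.
\<close>
lemma prox_optimality:
  assumes "convex_on C h" "e \<in> C" "\<eta> \<in> C"
    and min: "\<And>\<eta>. \<eta> \<in> C \<Longrightarrow> h e + \<phi> (w - e) \<le> h \<eta> + \<phi> (w - \<eta>)"
  shows "h e \<le> h \<eta> + D (e - w) \<bullet> (\<eta> - e)"
proof -
  define q where "q = (\<lambda>t. \<phi> (e - w + t *\<^sub>R (\<eta> - e)))"
  have "((\<lambda>t. e - w + t *\<^sub>R (\<eta> - e)) has_derivative (\<lambda>t. t *\<^sub>R (\<eta> - e))) (at 0)"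
    by (auto intro!: derivative_eq_intros)
  moreover have "(\<phi> has_derivative (\<lambda>h. h \<bullet> D (e - w))) (at (e - w + 0 *\<^sub>R (\<eta> - e)))"
    using GDERIV_phi[of "e - w"] unfolding gderiv_def by simp
  ultimately have "(q has_derivative (\<lambda>t. (t *\<^sub>R (\<eta> - e)) \<bullet> D (e - w))) (at 0)"
    unfolding q_def by (rule has_derivative_compose)
  moreover have "(\<lambda>t. (t *\<^sub>R (\<eta> - e)) \<bullet> D (e - w)) = (*) (D (e - w) \<bullet> (\<eta> - e))"
    by (simp add: fun_eq_iff inner_commute)
  ultimately have "(q has_real_derivative D (e - w) \<bullet> (\<eta> - e)) (at 0)"
    unfolding has_field_derivative_def by simp
  then have "(q has_real_derivative D (e - w) \<bullet> (\<eta> - e)) (at 0 within {0<..})"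
    by (rule has_field_derivative_at_within)
  then have lim: "((\<lambda>t. (q t - q 0) / (t - 0)) \<longlongrightarrow> D (e - w) \<bullet> (\<eta> - e)) (at_right 0)"
    unfolding has_field_derivative_iff .
  have "eventually (\<lambda>t::real. t \<in> {0<..<1}) (at_right 0)"
    by (rule eventually_at_right_real) simp
  then have "eventually (\<lambda>t. h e - h \<eta> \<le> (q t - q 0) / (t - 0)) (at_right 0)"
  proof (rule eventually_mono)
    fix t :: real assume t: "t \<in> {0<..<1}"
    let ?p = "(1 - t) *\<^sub>R e + t *\<^sub>R \<eta>"
    have "?p \<in> C" using assms(1-3) t unfolding convex_on_def
      by (intro convexD) auto
    from min[OF this] have "h e + \<phi> (e - w) \<le> h ?p + \<phi> (?p - w)"
      by (simp only: phi_diff_commute[of w])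
    also have "h ?p \<le> (1 - t) * h e + t * h \<eta>"
      using assms(1-3) t by (intro convex_onD) auto
    also have "?p - w = e - w + t *\<^sub>R (\<eta> - e)" by (simp add: algebra_simps)
    finally have "t * (h e - h \<eta>) \<le> q t - q 0" by (simp add: q_def algebra_simps)
    then show "h e - h \<eta> \<le> (q t - q 0) / (t - 0)" using t by (simp add: field_simps)
  qed
  from tendsto_lowerbound[OF lim this] show ?thesis by simp
qed

text \<open>
  The envelope is squeezed at \<open>w\<close> between two functions with gradient \<open>D (e - w)\<close>. Freezing the
  competitor \<open>\<eta> = e\<close> gives the lower one; adding the subgradient inequality for \<open>h\<close> at \<open>e\<close> to the
  tangent inequality for \<open>\<phi>\<close> at \<open>e - w\<close> gives the affine upper one.
\<close>
lemma GDERIV_envelope: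
  assumes "convex_on C h" "e \<in> C"
    and min: "\<And>\<eta>. \<eta> \<in> C \<Longrightarrow> h e + \<phi> (w - e) \<le> h \<eta> + \<phi> (w - \<eta>)"
    and F: "\<And>\<eta>. F \<eta> = (if \<eta> \<in> C then ereal (- h \<eta>) else -\<infinity>)"
  shows "GDERIV (\<lambda>y. real_of_ereal (SUP \<eta>. F \<eta> - ereal (\<phi> (y - \<eta>)))) w :> D (e - w)"
proof (rule GDERIV_sandwich)
  let ?M = "\<lambda>y. SUP \<eta>. F \<eta> - ereal (\<phi> (y - \<eta>))"
  let ?l = "\<lambda>y. - h e - \<phi> (e - y)"
  let ?u = "\<lambda>y. - h e - \<phi> (e - w) + (y - w) \<bullet> D (e - w)"
  have lower: "ereal (?l y) \<le> ?M y" for y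
    by (rule SUP_upper2[of e]) (auto simp: F assms(2) phi_diff_commute)
  have upper: "?M y \<le> ereal (?u y)" for y
  proof (rule SUP_least)
    fix \<eta>
    show "F \<eta> - ereal (\<phi> (y - \<eta>)) \<le> ereal (?u y)"
    proof (cases "\<eta> \<in> C")
      case True
      have "h e \<le> h \<eta> + D (e - w) \<bullet> (\<eta> - e)"
        by (rule prox_optimality[OF assms(1,2) True min])
      moreover have "\<phi> (e - w) + D (e - w) \<bullet> ((\<eta> - y) - (e - w)) \<le> \<phi> (\<eta> - y)"
        by (rule tangent_le)
      ultimately show ?thesis
        using True by (simp add: F phi_diff_commute[of y] algebra_simps inner_commute)
    qed (simp add: F)
  qed
  show lu: "?l y \<le> real_of_ereal (?M y)" "real_of_ereal (?M y) \<le> ?u y" for y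
    using lower[of y] upper[of y] by (cases "?M y"; simp)+
  show "?l w = real_of_ereal (?M w)" "?u w = real_of_ereal (?M w)"
    using lu[of w] by simp_all
  have "(\<phi> has_derivative (\<lambda>h. h \<bullet> D (e - w))) (at (e - w))"
    using GDERIV_phi unfolding gderiv_def .
  then have "((\<lambda>y. \<phi> (e - y)) has_derivative (\<lambda>h. (- h) \<bullet> D (e - w))) (at w)"
    by (rule has_derivative_compose[rotated]) (auto intro!: derivative_eq_intros)
  then have "((\<lambda>y. - h e - \<phi> (e - y)) has_derivative (\<lambda>h. 0 - (- h) \<bullet> D (e - w))) (at w)"
    by (intro has_derivative_diff has_derivative_const)
  then show "GDERIV ?l w :> D (e - w)" unfolding gderiv_def by simp
  show "GDERIV ?u w :> D (e - w)"
    unfolding gderiv_def by (auto intro!: derivative_eq_intros)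
qed

text \<open>
  The inequality behind the rate. The test point \<open>\<theta> a + (1 - \<theta>) v\<close> shares its first part with the prox
  centre \<open>\<theta> a + (1 - \<theta>) y0\<close>, so only \<open>(1 - \<theta>) (y0 - v)\<close> is penalised, and homogeneity turns the factor
  \<open>1 - \<theta>\<close> into the small number \<open>(1 - \<theta>)^s\<close>. The alternative \<open>\<theta> = 0\<close> is the first iteration of the
  method, whose starting point may lie outside \<open>C\<close>.
\<close>
lemma prox_test_point:
  assumes cvx: "convex_on C h" and \<theta>: "\<theta> \<in> {0..1}"
    and a: "\<theta> = 0 \<or> a \<in> C" and v: "v \<in> C"
    and min: "\<And>\<eta>. \<eta> \<in> C \<Longrightarrow>
      h e + \<phi> (\<theta> *\<^sub>R a + (1 - \<theta>) *\<^sub>R y0 - e) \<le> h \<eta> + \<phi> (\<theta> *\<^sub>R a + (1 - \<theta>) *\<^sub>R y0 - \<eta>)"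
  shows "h e \<le> \<theta> * h a + (1 - \<theta>) * h v + (1 - \<theta>) powr s * \<phi> (y0 - v)"
proof -
  let ?p = "\<theta> *\<^sub>R a + (1 - \<theta>) *\<^sub>R v"
  have p: "?p \<in> C" "h ?p \<le> \<theta> * h a + (1 - \<theta>) * h v"
  proof -
    show "?p \<in> C" using cvx \<theta> a v unfolding convex_on_def by (auto intro: convexD)
    show "h ?p \<le> \<theta> * h a + (1 - \<theta>) * h v"
      using a convex_onD[OF cvx, of "1 - \<theta>" a v] \<theta> v by auto
  qed
  have "\<theta> *\<^sub>R a + (1 - \<theta>) *\<^sub>R y0 - ?p = (1 - \<theta>) *\<^sub>R (y0 - v)" by (simp add: algebra_simps)
  then have "\<phi> (\<theta> *\<^sub>R a + (1 - \<theta>) *\<^sub>R y0 - ?p) = (1 - \<theta>) powr s * \<phi> (y0 - v)"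
    using \<theta> by (simp add: homogeneous)
  with min[OF p(1)] p(2) phi_nonneg[of "\<theta> *\<^sub>R a + (1 - \<theta>) *\<^sub>R y0 - e"] show ?thesis by linarith
qed

end

section \<open>The prox-functions of the method\<close>

lemma lnorm_2: "lnorm 2 x = norm x"
proof -
  have "0 \<le> (\<Sum>i\<in>UNIV. \<bar>x $ i\<bar> powr 2)" by (intro sum_nonneg) auto
  then show ?thesis
    by (simp add: lnorm_def norm_vec_def L2_set_def powr_half_sqrt)
qed

lemma prox_fun_2: "prox_fun 2 p x = norm x powr (p + 1) / (p + 1)"
  by (simp add: prox_fun_def lnorm_2)

lemma prox_fun_separable:
  assumes "p \<ge> 1"
  shows "prox_fun (p + 1) p x = (\<Sum>i\<in>UNIV. \<bar>x $ i\<bar> powr (p + 1) / (p + 1))"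
proof -
  have "0 \<le> (\<Sum>i\<in>UNIV. \<bar>x $ i\<bar> powr (p + 1))" by (intro sum_nonneg) auto
  then show ?thesis using assms
    by (simp add: prox_fun_def lnorm_def powr_powr sum_divide_distrib)
qed

lemma GDERIV_cdiv:
  fixes f :: "'a::real_inner \<Rightarrow> real"
  assumes "GDERIV f x :> c *\<^sub>R d" "c > 0"
  shows "GDERIV (\<lambda>x. f x / c) x :> d"
proof -
  have "((\<lambda>x. f x / c) has_derivative (\<lambda>h. (h \<bullet> (c *\<^sub>R d)) / c)) (at x)"
    using assms(1) unfolding gderiv_def divide_inverse by (rule has_derivative_mult_left)
  then show ?thesis using assms(2) by (simp add: gderiv_def)
qed

lemma GDERIV_norm_powr_div:
  fixes z :: "'a::real_inner"
  assumes "p \<ge> 1"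
  shows "GDERIV (\<lambda>x. norm x powr (p + 1) / (p + 1)) z :> norm z powr (p - 1) *\<^sub>R z"
proof (rule GDERIV_cdiv)
  show "GDERIV (\<lambda>x. norm x powr (p + 1)) z :> (p + 1) *\<^sub>R norm z powr (p - 1) *\<^sub>R z"
    using GDERIV_norm_powr[of "p + 1" z] assms by simp
qed (use assms in simp)

lemma norm_powr_div_tangent:
  fixes x z :: "'a::real_inner"
  assumes "p \<ge> 1" "x \<noteq> z"
  shows "norm z powr (p + 1) / (p + 1) + (norm z powr (p - 1) *\<^sub>R z) \<bullet> (x - z)
    < norm x powr (p + 1) / (p + 1)"
proof -
  have "norm z powr (p + 1) + (p + 1) * ((norm z powr (p - 1) *\<^sub>R z) \<bullet> (x - z)) < norm x powr (p + 1)"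
    using norm_powr_tangent[of "p + 1" x z] assms by (simp add: mult.assoc)
  then have "(norm z powr (p + 1) + (p + 1) * ((norm z powr (p - 1) *\<^sub>R z) \<bullet> (x - z))) / (p + 1)
      < norm x powr (p + 1) / (p + 1)"
    using assms by (intro divide_strict_right_mono) auto
  then show ?thesis using assms by (simp add: add_divide_distrib)
qed

lemma prox_kernel_euclidean:
  assumes "p \<ge> 1"
  shows "prox_kernel (prox_fun 2 p :: real ^ 'm \<Rightarrow> real) (\<lambda>z. norm z powr (p - 1) *\<^sub>R z) (p + 1)"
proof
  show "GDERIV (prox_fun 2 p) z :> norm z powr (p - 1) *\<^sub>R z" for z :: "real ^ 'm"
    unfolding prox_fun_2[abs_def] by (rule GDERIV_norm_powr_div[OF assms])
  show "prox_fun 2 p z + (norm z powr (p - 1) *\<^sub>R z) \<bullet> (x - z) < prox_fun 2 p x"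
    if "x \<noteq> z" for x z :: "real ^ 'm"
    unfolding prox_fun_2 by (rule norm_powr_div_tangent[OF assms that])
  show "prox_fun 2 p (t *\<^sub>R x) = \<bar>t\<bar> powr (p + 1) * prox_fun 2 p x" for t and x :: "real ^ 'm"
    by (simp add: prox_fun_2 powr_mult)
qed (use assms in simp)

lemma prox_kernel_separable:
  assumes "p \<ge> 1"
  shows "prox_kernel (prox_fun (p + 1) p :: real ^ 'm \<Rightarrow> real)
           (\<lambda>z. \<chi> i. \<bar>z $ i\<bar> powr (p - 1) * z $ i) (p + 1)"
proof
  fix x z :: "real ^ 'm" and t :: real
  let ?D = "\<chi> i. \<bar>z $ i\<bar> powr (p - 1) * z $ i"
  have "((\<lambda>x. \<bar>x $ i\<bar> powr (p + 1) / (p + 1))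
      has_derivative (\<lambda>h. h $ i * (\<bar>z $ i\<bar> powr (p - 1) * z $ i))) (at z)" for i
  proof (rule has_derivative_compose[of "\<lambda>x. x $ i" "\<lambda>h. h $ i" z])
    show "((\<lambda>x. x $ i) has_derivative (\<lambda>h. h $ i)) (at z)"
      by (rule bounded_linear.has_derivative[OF bounded_linear_vec_nth has_derivative_ident])
    show "((\<lambda>t. \<bar>t\<bar> powr (p + 1) / (p + 1))
        has_derivative (\<lambda>h. h * (\<bar>z $ i\<bar> powr (p - 1) * z $ i))) (at (z $ i))"
      using GDERIV_norm_powr_div[OF assms, of "z $ i"] unfolding gderiv_def by simp
  qed
  then have "((\<lambda>x. \<Sum>i\<in>UNIV. \<bar>x $ i\<bar> powr (p + 1) / (p + 1)) has_derivative
      (\<lambda>h. \<Sum>i\<in>UNIV. h $ i * (\<bar>z $ i\<bar> powr (p - 1) * z $ i))) (at z)"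
    by (rule has_derivative_sum)
  then show "GDERIV (prox_fun (p + 1) p) z :> ?D"
    unfolding gderiv_def prox_fun_separable[OF assms, abs_def] inner_vec_def by simp
  show "prox_fun (p + 1) p (t *\<^sub>R x) = \<bar>t\<bar> powr (p + 1) * prox_fun (p + 1) p x"
    by (simp add: prox_fun_separable[OF assms] sum_distrib_left abs_mult powr_mult)
  assume "x \<noteq> z"
  then obtain j where j: "x $ j \<noteq> z $ j" by (auto simp: vec_eq_iff)
  have lt: "\<bar>b\<bar> powr (p + 1) / (p + 1) + \<bar>b\<bar> powr (p - 1) * b * (a - b) < \<bar>a\<bar> powr (p + 1) / (p + 1)"
    if "a \<noteq> b" for a b :: real
    using norm_powr_div_tangent[OF assms that] by simp
  have "(\<Sum>i\<in>UNIV. \<bar>z $ i\<bar> powr (p + 1) / (p + 1) + \<bar>z $ i\<bar> powr (p - 1) * z $ i * (x $ i - z $ i))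
      < (\<Sum>i\<in>UNIV. \<bar>x $ i\<bar> powr (p + 1) / (p + 1))"
  proof (rule sum_strict_mono_ex1)
    show "\<forall>i\<in>UNIV. \<bar>z $ i\<bar> powr (p + 1) / (p + 1) + \<bar>z $ i\<bar> powr (p - 1) * z $ i * (x $ i - z $ i)
        \<le> \<bar>x $ i\<bar> powr (p + 1) / (p + 1)"
    proof
      fix i
      show "\<bar>z $ i\<bar> powr (p + 1) / (p + 1) + \<bar>z $ i\<bar> powr (p - 1) * z $ i * (x $ i - z $ i)
        \<le> \<bar>x $ i\<bar> powr (p + 1) / (p + 1)"
        using lt[of "x $ i" "z $ i"] by (cases "x $ i = z $ i") auto
    qed
    show "\<exists>i\<in>UNIV. \<bar>z $ i\<bar> powr (p + 1) / (p + 1) + \<bar>z $ i\<bar> powr (p - 1) * z $ i * (x $ i - z $ i)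
        < \<bar>x $ i\<bar> powr (p + 1) / (p + 1)"
      using lt[OF j] by blast
  qed simp
  then show "prox_fun (p + 1) p z + ?D \<bullet> (x - z) < prox_fun (p + 1) p x"
    by (simp add: prox_fun_separable[OF assms] inner_vec_def sum.distrib)
qed (use assms in simp)

lemma prox_kernel_prox_fun:
  assumes "r = 2 \<or> r = p + 1" "p \<ge> 1"
  obtains D where "prox_kernel (prox_fun r p :: real ^ 'm \<Rightarrow> real) D (p + 1)"
  using assms(1)
proof
  assume "r = 2"
  then show thesis using that prox_kernel_euclidean[OF assms(2)] by simp
next
  assume "r = p + 1"
  then show thesis using that prox_kernel_separable[OF assms(2)] by simp
qed

section \<open>The Lagrangian as a function of the multiplier\<close>

text \<open>
  Each point of the epigraph of \<open>g\<close> imposes one affine inequality, so the epigraph of the conjugate is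
  an intersection of closed half-spaces. Its convexity and closedness are both read off this form.
\<close>
lemma conjugate_le_iff:
  "conjugate g u \<le> ereal t \<longleftrightarrow> (\<forall>z a. g z \<le> ereal a \<longrightarrow> z \<bullet> u - a \<le> t)"
proof -
  have "ereal (z \<bullet> u) - g z \<le> ereal t \<longleftrightarrow> (\<forall>a. g z \<le> ereal a \<longrightarrow> z \<bullet> u - a \<le> t)" for z
  proof (cases "g z")
    case (real b)
    show ?thesis
    proof
      assume "\<forall>a. g z \<le> ereal a \<longrightarrow> z \<bullet> u - a \<le> t"
      then show "ereal (z \<bullet> u) - g z \<le> ereal t" using real by simp
    qed (use real in auto)
  next
    case MInf
    have "\<not> z \<bullet> u - (z \<bullet> u - t - 1) \<le> t" by simp
    then have "\<exists>a. \<not> z \<bullet> u - a \<le> t" by (rule exI)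
    then show ?thesis using MInf by simp
  qed auto
  then show ?thesis by (simp add: conjugate_def SUP_le_iff)
qed

lemma conjugate_eq_real:
  assumes "proper g" "v \<in> effective_domain (conjugate g)"
  shows "conjugate g v = ereal (real_of_ereal (conjugate g v))"
proof -
  obtain z a where z: "g z \<le> ereal a"
    using assms(1) unfolding proper_def by (metis ereal_cases order_refl)
  have "conjugate g v \<noteq> -\<infinity>"
  proof
    assume "conjugate g v = -\<infinity>"
    then have "conjugate g v \<le> ereal (z \<bullet> v - a - 1)" by simp
    then have "z \<bullet> v - a \<le> z \<bullet> v - a - 1" using z unfolding conjugate_le_iff by blast
    then show False by simp
  qed
  then show ?thesis using assms(2) by (cases "conjugate g v") (auto simp: effective_domain_def)
qed

lemma lagrangian_finite:
  assumes "proper f" "proper g" "u \<in> effective_domain f" "v \<in> effective_domain (conjugate g)"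
  shows "lagrangian f g \<A> u v
    = ereal (real_of_ereal (f u) + \<A> u \<bullet> v - real_of_ereal (conjugate g v))"
proof -
  have "f u = ereal (real_of_ereal (f u))"
    using assms(1,3) by (cases "f u") (auto simp: proper_def effective_domain_def)
  then show ?thesis using conjugate_eq_real[OF assms(2,4)] assms(3,4)
    unfolding lagrangian_def by (metis ereal_minus(1) plus_ereal.simps(1))
qed

text \<open>
  The same half-spaces, tilted by \<open>\<A> u\<close> and shifted by \<open>f u\<close>, cut out the epigraph of \<open>v \<mapsto> - L u v\<close>.
  Membership in the domain has to be stated next to the inequality because \<open>real_of_ereal\<close> sends the
  value \<open>-\<infinity>\<close> taken outside the domain to \<open>0\<close>.
\<close>
lemma neg_lagrangian_le_iff:
  assumes "proper f" "proper g" "u \<in> effective_domain f"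
  shows "v \<in> effective_domain (conjugate g) \<and> - real_of_ereal (lagrangian f g \<A> u v) \<le> t
    \<longleftrightarrow> (\<forall>z a. g z \<le> ereal a \<longrightarrow> (z - \<A> u) \<bullet> v - a - real_of_ereal (f u) \<le> t)" (is "?l \<longleftrightarrow> ?r")
proof -
  have "?l \<longleftrightarrow> conjugate g v \<le> ereal (t + real_of_ereal (f u) + \<A> u \<bullet> v)"
  proof (cases "v \<in> effective_domain (conjugate g)")
    case True
    have "conjugate g v \<le> ereal (t + real_of_ereal (f u) + \<A> u \<bullet> v)
       \<longleftrightarrow> real_of_ereal (conjugate g v) \<le> t + real_of_ereal (f u) + \<A> u \<bullet> v"
      by (subst conjugate_eq_real[OF assms(2) True]) simp
    then show ?thesis using True lagrangian_finite[OF assms True] by auto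
  qed (auto simp: effective_domain_def)
  also have "\<dots> \<longleftrightarrow> ?r" unfolding conjugate_le_iff by (simp add: inner_diff_left algebra_simps)
  finally show ?thesis .
qed

lemma convex_on_neg_lagrangian:
  assumes "proper f" "proper g" "u \<in> effective_domain f"
  shows "convex_on (effective_domain (conjugate g)) (\<lambda>v. - real_of_ereal (lagrangian f g \<A> u v))"
    (is "convex_on ?C ?h")
proof -
  have "t *\<^sub>R v1 + (1 - t) *\<^sub>R v2 \<in> ?C \<and> ?h (t *\<^sub>R v1 + (1 - t) *\<^sub>R v2) \<le> t * ?h v1 + (1 - t) * ?h v2"
    if "0 \<le> t" "t \<le> 1" "v1 \<in> ?C" "v2 \<in> ?C" for t v1 v2
    unfolding neg_lagrangian_le_iff[OF assms]
  proof (intro allI impI)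
    fix z a assume z: "g z \<le> ereal a"
    let ?e = "\<lambda>v. (z - \<A> u) \<bullet> v - a - real_of_ereal (f u)"
    have "?e v1 \<le> ?h v1" "?e v2 \<le> ?h v2"
      using that z neg_lagrangian_le_iff[OF assms, of _ \<A>] by blast+
    then have "t * ?e v1 + (1 - t) * ?e v2 \<le> t * ?h v1 + (1 - t) * ?h v2"
      using that by (intro add_mono mult_left_mono) auto
    moreover have "t * ?e v1 + (1 - t) * ?e v2 = ?e (t *\<^sub>R v1 + (1 - t) *\<^sub>R v2)"
      by (simp add: inner_add_right algebra_simps)
    ultimately show "?e (t *\<^sub>R v1 + (1 - t) *\<^sub>R v2) \<le> t * ?h v1 + (1 - t) * ?h v2" by simp
  qed
  note * = this
  show ?thesis
    unfolding convex_on_def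
  proof (intro conjI ballI allI impI)
    show "convex ?C"
    proof (rule convexI)
      fix v1 v2 and \<alpha> \<beta> :: real assume "v1 \<in> ?C" "v2 \<in> ?C" "0 \<le> \<alpha>" "0 \<le> \<beta>" "\<alpha> + \<beta> = 1"
      moreover from this have "\<beta> = 1 - \<alpha>" "\<alpha> \<le> 1" by auto
      ultimately show "\<alpha> *\<^sub>R v1 + \<beta> *\<^sub>R v2 \<in> ?C" using *[of \<alpha> v1 v2] by blast
    qed
    fix v1 v2 and \<alpha> \<beta> :: real assume "v1 \<in> ?C" "v2 \<in> ?C" "0 \<le> \<alpha>" "0 \<le> \<beta>" "\<alpha> + \<beta> = 1"
    moreover from this have "\<beta> = 1 - \<alpha>" "\<alpha> \<le> 1" by auto
    ultimately show "?h (\<alpha> *\<^sub>R v1 + \<beta> *\<^sub>R v2) \<le> \<alpha> * ?h v1 + \<beta> * ?h v2" using *[of \<alpha> v1 v2] by blast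
  qed
qed

lemma closed_epigraph_neg_lagrangian:
  assumes "proper f" "proper g" "u \<in> effective_domain f"
  shows "closed {(v, t). v \<in> effective_domain (conjugate g)
      \<and> - real_of_ereal (lagrangian f g \<A> u v) \<le> t}"
  unfolding neg_lagrangian_le_iff[OF assms] case_prod_beta
  by (intro closed_Collect_all closed_Collect_imp closed_Collect_le continuous_intros) simp

text \<open>
  The two gradients in the update cancel: the augmented Lagrangian is the envelope of \<open>- h\<close>, so its
  gradient is \<open>D ((e - w) / lam)\<close> with \<open>e\<close> the proximal point, and the gradient of the conjugate
  prox-function maps this to \<open>(e - w) / lam\<close>.
\<close>
lemma alm_update_is_prox:
  fixes g :: "real ^ 'm \<Rightarrow> ereal"
  assumes "proper f" "proper g" and u: "u \<in> effective_domain f"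
    and ne: "effective_domain (conjugate g) \<noteq> {}"
    and "r = 2 \<or> r = p + 1" "p \<ge> 1" and lam: "lam > 0"
    and y: "y = w + lam *\<^sub>R grad (prox_conj r p) (grad_aug_lagrangian f g \<A> r p lam u w)"
  defines "h \<equiv> \<lambda>v. - real_of_ereal (lagrangian f g \<A> u v)"
    and "\<psi> \<equiv> epi_scale lam (prox_fun r p)"
  shows "y \<in> effective_domain (conjugate g)"
    and "\<And>v. v \<in> effective_domain (conjugate g) \<Longrightarrow> h y + \<psi> (w - y) \<le> h v + \<psi> (w - v)"
proof -
  let ?C = "effective_domain (conjugate g)"
  obtain D where "prox_kernel (prox_fun r p :: real ^ 'm \<Rightarrow> real) D (p + 1)"
    using prox_kernel_prox_fun[OF assms(5,6)] .
  then interpret \<phi>: prox_kernel "prox_fun r p :: real ^ 'm \<Rightarrow> real" D "p + 1" .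
  interpret \<psi>: prox_kernel \<psi> "\<lambda>z. D (z /\<^sub>R lam)" "p + 1"
    unfolding \<psi>_def by (rule \<phi>.prox_kernel_epi_scale[OF lam])
  have cvx: "convex_on ?C h" and cl: "closed {(v, t). v \<in> ?C \<and> h v \<le> t}"
    unfolding h_def
    by (fact convex_on_neg_lagrangian[OF assms(1-3)] closed_epigraph_neg_lagrangian[OF assms(1-3)])+
  obtain z a where "g z \<le> ereal a"
    using \<open>proper g\<close> unfolding proper_def by (metis ereal_cases order_refl)
  then have minorant: "(- a - real_of_ereal (f u)) + (z - \<A> u) \<bullet> v \<le> h v" if "v \<in> ?C" for v
    using that neg_lagrangian_le_iff[OF assms(1-3), of v \<A> "h v"] unfolding h_def by fastforce
  obtain c0 where "c0 \<in> ?C" using ne by blast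
  obtain e where e: "e \<in> ?C" "\<And>v. v \<in> ?C \<Longrightarrow> h e + \<psi> (w - e) \<le> h v + \<psi> (w - v)"
    using \<psi>.prox_point_exists[OF \<open>c0 \<in> ?C\<close> cl minorant] by metis
  have "lagrangian f g \<A> u v = (if v \<in> ?C then ereal (- h v) else -\<infinity>)" for v
    using u lagrangian_finite[OF assms(1-3), of v \<A>] by (auto simp: h_def lagrangian_def)
  from \<psi>.GDERIV_envelope[OF cvx e this]
  have "grad_aug_lagrangian f g \<A> r p lam u w = D ((e - w) /\<^sub>R lam)"
    unfolding grad_aug_lagrangian_def aug_lagrangian_def \<psi>_def[symmetric] by (rule grad_eqI)
  moreover have "grad (prox_conj r p) (D ((e - w) /\<^sub>R lam)) = (e - w) /\<^sub>R lam"
    unfolding prox_conj_def[abs_def] by (rule grad_eqI[OF \<phi>.GDERIV_conjugate])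
  ultimately have "y = e" using y lam by simp
  then show "y \<in> ?C" "\<And>v. v \<in> ?C \<Longrightarrow> h y + \<psi> (w - y) \<le> h v + \<psi> (w - v)" using e by auto
qed

text \<open>
  If the conjugate were infinite everywhere, the dual value would be \<open>-\<infinity>\<close>; by strong duality so would
  the primal value, but that value is attained and a sum of proper functions is never \<open>-\<infinity>\<close>.
\<close>
lemma conjugate_domain_nonempty:
  assumes "proper f" "proper g"
    and sd: "(SUP v. INF u. lagrangian f g \<A> u v) = (INF u. primal_obj f g \<A> u)"
    and sol: "\<exists>u. is_arg_min (primal_obj f g \<A>) (\<lambda>_. True) u"
  shows "effective_domain (conjugate g) \<noteq> {}"
proof
  assume empty: "effective_domain (conjugate g) = {}"
  obtain u0 where u0: "u0 \<in> effective_domain f"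
    using \<open>proper f\<close> by (auto simp: proper_def effective_domain_def)
  have "(INF u. lagrangian f g \<A> u v) = -\<infinity>" for v
    using INF_lower[of u0 UNIV "\<lambda>u. lagrangian f g \<A> u v"] u0 empty by (simp add: lagrangian_def)
  then have inf: "(INF u. primal_obj f g \<A> u) = -\<infinity>" using sd by simp
  obtain u where "\<And>u'. primal_obj f g \<A> u \<le> primal_obj f g \<A> u'"
    using sol by (auto simp: is_arg_min_linorder)
  then have "primal_obj f g \<A> u \<le> -\<infinity>" unfolding inf[symmetric] by (intro INF_greatest)
  then show False using assms(1,2) unfolding primal_obj_def proper_def
    by (metis ereal_infty_less_eq(2) ereal_plus_eq_MInfty)
qed

section \<open>The rate of convergence\<close>

text \<open>
  Jensen's inequality for extended-valued functions, in terms of real upper bounds so that no infinite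
  value has to be scaled or added.
\<close>
lemma convex_fun_sum_le:
  assumes "convex_fun F" "finite S" "(\<Sum>i\<in>S. c i) = 1" "\<And>i. i \<in> S \<Longrightarrow> c i \<ge> 0"
    and "\<And>i. i \<in> S \<Longrightarrow> F (x i) \<le> ereal (t i)"
  shows "F (\<Sum>i\<in>S. c i *\<^sub>R x i) \<le> ereal (\<Sum>i\<in>S. c i * t i)"
proof -
  have "(\<Sum>i\<in>S. c i *\<^sub>R (x i, t i)) \<in> {(x, t). F x \<le> ereal t}"
    using assms unfolding convex_fun_def by (intro convex_sum) auto
  moreover have "(\<Sum>i\<in>S. c i *\<^sub>R (x i, t i)) = (\<Sum>i\<in>S. c i *\<^sub>R x i, \<Sum>i\<in>S. c i * t i)"
    by (simp add: prod_eq_iff fst_sum snd_sum)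
  ultimately show ?thesis by simp
qed

lemma powr_increment_le:
  assumes "p \<ge> 1"
  shows "real (Suc k) powr (p + 1) - real k powr (p + 1) \<le> (p + 1) * real (Suc k) powr p"
  using powr_tangent[of "p + 1" "real k" "real (Suc k)"] assms by simp

theorem theorem4p2:
  fixes f :: "real ^ 'n \<Rightarrow> ereal"
    and g :: "real ^ 'm \<Rightarrow> ereal"
    and \<A> :: "real ^ 'n \<Rightarrow> real ^ 'm"
    and r p lam c :: real
    and A a \<epsilon> :: "nat \<Rightarrow> real"
    and x xavg :: "nat \<Rightarrow> real ^ 'n"
    and y :: "nat \<Rightarrow> real ^ 'm"
  assumes f: "proper f" "lsc f" "convex_fun f"
    and g: "proper g" "lsc g" "convex_fun g"
    and primal_convex: "convex_fun (primal_obj f g \<A>)"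
    and L_convex: "\<And>v. convex_fun (\<lambda>u. lagrangian f g \<A> u v)"
    and L_concave: "\<And>u. concave_fun (\<lambda>v. lagrangian f g \<A> u v)"
    and strong_duality:
      "(SUP v. INF u. lagrangian f g \<A> u v) = (INF u. primal_obj f g \<A> u)"
    and primal_solution: "\<exists>u. is_arg_min (primal_obj f g \<A>) (\<lambda>_. True) u"
    and dual_solution: "\<exists>v. is_arg_max (\<lambda>v. INF u. lagrangian f g \<A> u v) (\<lambda>_. True) v"
    and r: "r = 2 \<or> r = p + 1"
    and p: "p \<ge> 1"
    and lam: "lam > 0"
    and c: "c \<ge> 0"
    and eps: "\<And>k. \<epsilon> k = c / (real k + 1) powr (p + 1)"
    and A: "\<And>k. A k = real k powr (p + 1)"
    and a: "\<And>k. k \<ge> 1 \<Longrightarrow> a k = A k - A (k - 1)"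
    and generated: "inexact_power_alm f g \<A> r p lam (\<lambda>k. A k / A (k + 1)) x y"
    and stopping: "\<And>k. lagrangian f g \<A> (x (k + 1)) (y (k + 1))
                         \<le> (INF u. lagrangian f g \<A> u (y (k + 1))) + ereal (\<epsilon> k)"
    and xavg: "\<And>K. K \<ge> 1 \<Longrightarrow> xavg K = (\<Sum>k=1..K. a k *\<^sub>R x k) /\<^sub>R (\<Sum>k=1..K. a k)"
  shows "\<forall>K\<ge>1. \<forall>u v. lagrangian f g \<A> (xavg K) v - lagrangian f g \<A> u (y K)
           \<le> ereal ((c + epi_scale lam (prox_fun r p) (y 0 - v) * (p + 1) powr (p + 1))
                      / real K powr p)"
proof -
  let ?C = "effective_domain (conjugate g)"
  define R where "R = (\<lambda>u v. real_of_ereal (lagrangian f g \<A> u v))"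
  have L: "lagrangian f g \<A> u v = ereal (R u v)" if "u \<in> effective_domain f" "v \<in> ?C" for u v
    using lagrangian_finite[OF f(1) g(1) that, of \<A>] by (simp add: R_def)
  define \<psi> where "\<psi> = epi_scale lam (prox_fun r p :: real ^ 'm \<Rightarrow> real)"
  obtain D where "prox_kernel (prox_fun r p :: real ^ 'm \<Rightarrow> real) D (p + 1)"
    using prox_kernel_prox_fun[OF r p] .
  then interpret \<psi>: prox_kernel \<psi> "\<lambda>z. D (z /\<^sub>R lam)" "p + 1"
    unfolding \<psi>_def using lam by (rule prox_kernel.prox_kernel_epi_scale)
  have ne: "?C \<noteq> {}"
    by (rule conjugate_domain_nonempty[OF f(1) g(1) strong_duality primal_solution])

  define \<theta> where "\<theta> = (\<lambda>k. A k / A (k + 1))"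
  define w where "w = (\<lambda>k. \<theta> k *\<^sub>R y k + (1 - \<theta> k) *\<^sub>R y 0)"
  have gen: "\<theta> k \<in> {0..1}" "x (Suc k) \<in> effective_domain f"
    "y (Suc k) = w k
      + lam *\<^sub>R grad (prox_conj r p) (grad_aug_lagrangian f g \<A> r p lam (x (Suc k)) (w k))" for k
    using generated unfolding inexact_power_alm_def \<theta>_def w_def Let_def by blast+
  note prox = alm_update_is_prox[OF f(1) g(1) gen(2) ne r p lam gen(3), folded \<psi>_def]
  have yC: "y (Suc k) \<in> ?C" for k by (rule prox(1))
  have A_pos: "A (Suc k) > 0" for k by (simp add: A)
  have A_0: "A 0 = 0" by (simp add: A)
  have a_nonneg: "a k \<ge> 0" if "k \<ge> 1" for k
    using that p by (auto simp: a A intro!: powr_mono2)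

  have step: "A k * R (x (Suc k)) (y k) + a (Suc k) * R (x (Suc k)) v
      \<le> A (Suc k) * R (x (Suc k)) (y (Suc k)) + \<psi> (y 0 - v) * (p + 1) powr (p + 1)"
    if v: "v \<in> ?C" for k v
  proof -
    \<comment> \<open>\<open>A 0 = 0\<close>, so the initial multiplier, which need not lie in \<open>?C\<close>, gets weight zero.\<close>
    have "\<theta> k = 0 \<or> y k \<in> ?C"
      using yC[of "k - 1"] by (cases k) (auto simp: \<theta>_def A_0)
    from \<psi>.prox_test_point[OF convex_on_neg_lagrangian[OF f(1) g(1) gen(2)] gen(1) this v
        prox(2)[unfolded w_def]]
    have "\<theta> k * R (x (Suc k)) (y k) + (1 - \<theta> k) * R (x (Suc k)) v
        \<le> R (x (Suc k)) (y (Suc k)) + (1 - \<theta> k) powr (p + 1) * \<psi> (y 0 - v)"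
      unfolding R_def by simp
    then have "A (Suc k) * (\<theta> k * R (x (Suc k)) (y k) + (1 - \<theta> k) * R (x (Suc k)) v)
        \<le> A (Suc k) * (R (x (Suc k)) (y (Suc k)) + (1 - \<theta> k) powr (p + 1) * \<psi> (y 0 - v))"
      using A_pos[of k] by (intro mult_left_mono) auto
    moreover have A\<theta>: "A (Suc k) * \<theta> k = A k" "A (Suc k) * (1 - \<theta> k) = a (Suc k)"
      using A_pos[of k] by (simp_all add: \<theta>_def a right_diff_distrib)
    moreover have "A (Suc k) * (1 - \<theta> k) powr (p + 1) \<le> (p + 1) powr (p + 1)"
    proof -
      have "a (Suc k) \<le> (p + 1) * real (Suc k) powr p"
        using powr_increment_le[OF p, of k] by (simp add: a A)
      also have "real (Suc k) powr p = A (Suc k) / real (Suc k)"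
        unfolding A by (simp add: powr_add)
      finally have "A (Suc k) * (1 - \<theta> k) \<le> A (Suc k) * ((p + 1) / real (Suc k))"
        by (simp add: A\<theta> mult.commute)
      then have "1 - \<theta> k \<le> (p + 1) / real (Suc k)"
        using A_pos[of k] by (rule mult_left_le_imp_le)
      then have "(1 - \<theta> k) powr (p + 1) \<le> ((p + 1) / real (Suc k)) powr (p + 1)"
        using gen(1)[of k] p by (intro powr_mono2) auto
      \<comment> \<open>Here \<open>1 - \<theta> k = a (k+1) / A (k+1)\<close> is of order \<open>1 / (k+1)\<close>, and \<open>p + 1\<close> is the
      exponent for which its power cancels \<open>A (k+1)\<close>.\<close>
    also have "\<dots> = (p + 1) powr (p + 1) / A (Suc k)"
        using p by (simp add: A powr_divide)
      finally show ?thesis using A_pos[of k] by (simp add: pos_le_divide_eq mult.commute)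
    qed
    then have "(A (Suc k) * (1 - \<theta> k) powr (p + 1)) * \<psi> (y 0 - v)
        \<le> (p + 1) powr (p + 1) * \<psi> (y 0 - v)"
      using \<psi>.phi_nonneg by (intro mult_right_mono) auto
    ultimately show ?thesis
      unfolding distrib_left mult.assoc[symmetric] by (simp add: mult.commute)
  qed

  have stop: "R (x (Suc k)) (y (Suc k)) \<le> R u (y (Suc k)) + c / A (Suc k)"
    if u: "u \<in> effective_domain f" for k u
  proof -
    have "ereal (R (x (Suc k)) (y (Suc k)))
        \<le> (INF u. lagrangian f g \<A> u (y (Suc k))) + ereal (\<epsilon> k)"
      using stopping[of k] by (simp add: L gen(2) yC)
    also have "\<dots> \<le> lagrangian f g \<A> u (y (Suc k)) + ereal (\<epsilon> k)"
      by (intro add_right_mono INF_lower) simp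
    also have "\<dots> = ereal (R u (y (Suc k)) + \<epsilon> k)"
      by (simp add: L u yC)
    finally show ?thesis by (simp add: eps A add.commute)
  qed

  \<comment> \<open>The stopping error of the last iterate is left out here, whence \<open>n\<close> and not \<open>n + 1\<close> copies of \<open>c\<close>;
    it is spent when \<open>x K\<close> is compared with an arbitrary \<open>u\<close>.\<close>
  have telescoped: "(\<Sum>k=1..Suc n. a k * R (x k) v)
      \<le> A (Suc n) * R (x (Suc n)) (y (Suc n)) + real n * c
        + real (Suc n) * (\<psi> (y 0 - v) * (p + 1) powr (p + 1))"
    if v: "v \<in> ?C" for n v
  proof (induction n)
    case 0
    show ?case using step[OF v, of 0] by (simp add: A_0)
  next
    case (Suc n)
    have "A (Suc n) * R (x (Suc n)) (y (Suc n))
        \<le> A (Suc n) * (R (x (Suc (Suc n))) (y (Suc n)) + c / A (Suc n))"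
      using A_pos[of n] by (intro mult_left_mono stop gen(2)) auto
    also have "\<dots> = A (Suc n) * R (x (Suc (Suc n))) (y (Suc n)) + c"
      using A_pos[of n] by (simp add: distrib_left)
    finally show ?case
      using Suc.IH step[OF v, of "Suc n"] by (simp add: algebra_simps)
  qed

  have sum_a: "(\<Sum>k=1..n. a k) = A n" for n
    by (induction n) (simp_all add: A_0 a)

  have avg: "lagrangian f g \<A> (xavg (Suc n)) v \<le> ereal ((\<Sum>k=1..Suc n. a k * R (x k) v) / A (Suc n))"
    if v: "v \<in> ?C" for n v
  proof -
    have "lagrangian f g \<A> (\<Sum>k=1..Suc n. (a k / A (Suc n)) *\<^sub>R x k) v
        \<le> ereal (\<Sum>k=1..Suc n. (a k / A (Suc n)) * R (x k) v)"
    proof (rule convex_fun_sum_le[OF L_convex])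
      show "(\<Sum>k=1..Suc n. a k / A (Suc n)) = 1"
        using A_pos[of n] sum_a[of "Suc n"] by (simp only: flip: sum_divide_distrib) simp
      fix k assume k: "k \<in> {1..Suc n}"
      then show "0 \<le> a k / A (Suc n)" using a_nonneg[of k] A_pos[of n] by simp
      have "x k \<in> effective_domain f" using k gen(2)[of "k - 1"] by simp
      then show "lagrangian f g \<A> (x k) v \<le> ereal (R (x k) v)" by (simp add: L v)
    qed simp
    moreover have "xavg (Suc n) = (\<Sum>k=1..Suc n. (a k / A (Suc n)) *\<^sub>R x k)"
    proof -
      have "xavg (Suc n) = (\<Sum>k=1..Suc n. a k *\<^sub>R x k) /\<^sub>R A (Suc n)"
        using xavg[of "Suc n"] sum_a[of "Suc n"] by simp
      then show ?thesis
        by (simp only: scaleR_sum_right scaleR_scaleR divide_inverse mult.commute)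
    qed
    ultimately show ?thesis by (simp only: sum_divide_distrib times_divide_eq_left)
  qed

  show ?thesis
  proof (intro allI impI)
    fix K :: nat and u v assume "1 \<le> K"
    then obtain n where K: "K = Suc n" by (cases K) auto
    let ?E = "\<psi> (y 0 - v) * (p + 1) powr (p + 1)"
    obtain v0 where v0: "v0 \<in> ?C" using ne by blast
    \<comment> \<open>Any multiplier in \<open>?C\<close> shows that the average stays in the domain of \<open>f\<close>, since \<open>L\<close> is \<open>\<infinity>\<close> off it.\<close>
    have xavg_dom: "xavg K \<in> effective_domain f"
      using avg[OF v0, of n] unfolding K lagrangian_def by (auto split: if_splits)
    then obtain l where l: "lagrangian f g \<A> (xavg K) v = ereal l \<and> v \<in> ?C
        \<or> lagrangian f g \<A> (xavg K) v = -\<infinity>"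
      using L[of "xavg K" v] by (cases "v \<in> ?C") (auto simp: lagrangian_def)
    \<comment> \<open>Outside the domains the left-hand side is \<open>-\<infinity>\<close>. In the second case this uses that \<open>y K\<close> is in \<open>?C\<close>,
      because \<open>-\<infinity> - (-\<infinity>) = \<infinity>\<close> in the extended reals.\<close>
    consider "u \<notin> effective_domain f" | "u \<in> effective_domain f" "v \<notin> ?C"
      | "u \<in> effective_domain f" "v \<in> ?C" by blast
    then have "lagrangian f g \<A> (xavg K) v - lagrangian f g \<A> u (y K) \<le> ereal ((c + ?E) / real K powr p)"
    proof cases
      case 1
      then have "lagrangian f g \<A> u (y K) = \<infinity>" by (simp add: lagrangian_def)
      then show ?thesis using l by auto
    next
      case 2
      then have "lagrangian f g \<A> (xavg K) v = -\<infinity>" using xavg_dom by (simp add: lagrangian_def)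
      then show ?thesis using L[OF 2(1) yC[of n]] by (simp add: K)
    next
      case 3
      have AK: "A K > 0" "A K = real K * real K powr p"
        using A_pos[of n] by (simp_all add: K A powr_add)
      have frac: "real K * (c + ?E) / A K = (c + ?E) / real K powr p"
        unfolding AK(2) using \<open>1 \<le> K\<close> by (intro mult_divide_mult_cancel_left) simp
      have "(\<Sum>k=1..K. a k * R (x k) v) \<le> A K * R (x K) (y K) + real n * c + real K * ?E"
        using telescoped[OF 3(2), of n] by (simp only: K)
      also have "A K * R (x K) (y K) \<le> A K * (R u (y K) + c / A K)"
        unfolding K using A_pos[of n] by (intro mult_left_mono stop 3) auto
      also have "\<dots> = A K * R u (y K) + c" using AK(1) by (simp add: distrib_left)
      finally have "(\<Sum>k=1..K. a k * R (x k) v) \<le> A K * R u (y K) + real K * (c + ?E)"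
        by (simp add: K algebra_simps)
      then have "(\<Sum>k=1..K. a k * R (x k) v) / A K \<le> (A K * R u (y K) + real K * (c + ?E)) / A K"
        using AK(1) by (intro divide_right_mono) auto
      also have "\<dots> = R u (y K) + (c + ?E) / real K powr p"
        unfolding frac[symmetric] using AK(1) by (simp add: add_divide_distrib)
      finally have "lagrangian f g \<A> (xavg K) v \<le> ereal (R u (y K) + (c + ?E) / real K powr p)"
        using avg[OF 3(2), of n] unfolding K by (meson ereal_less_eq(3) order_trans)
      moreover have "lagrangian f g \<A> u (y K) = ereal (R u (y K))"
        using L[OF 3(1) yC[of n]] by (simp add: K)
      ultimately show ?thesis using l by auto
    qed
    then show "lagrangian f g \<A> (xavg K) v - lagrangian f g \<A> u (y K)
        \<le> ereal ((c + epi_scale lam (prox_fun r p) (y 0 - v) * (p + 1) powr (p + 1)) / real K powr p)"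
      by (simp only: \<psi>_def)
  qed
qed

end
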